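(* Let $R\subset S$ be a ring extension which is not minimal. The following statements are equivalent: (1) for every $R$-subalgebra $T$ of $S$ with $T\neq R,S$, the extension $R\subset T$ is minimal; (2) for every $R$-subalgebra $T$ of $S$ with $T\neq R,S$, the extension $T\subset S$ is minimal; (3) $\ell[R,S]=2$. Hence, an extension $R\subset S$ with $|[R,S]|=3$ has length $2$.
   Context: Rings are commutative and unital; $R\subset S$ denotes a proper ring extension. $[R,S]$ is the set of all $R$-subalgebras of $S$ (including $R$ and $S$), ordered by inclusion. An extension $A\subset B$ (with $A\neq B$) is minimal if $[A,B]=\{A,B\}$. The length $\ell[R,S]$ is the supremum of the lengths of chains of elements of $[R,S]$, where a chain $R_0\subset R_1\subset\cdots\subset R_n$ has length $n$; "$R\subset S$ has length 2" means $\ell[R,S]=2$. *)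

theory Defs
  imports "HOL-Algebra.Subrings" "HOL-Library.Extended_Nat"
begin

text \<open>
  The larger ring \<open>S\<close> is a ring record and the base ring \<open>R\<close> is a subset of its carrier.
  A subset \<open>T\<close> of \<open>carrier S\<close> is itself used as the larger ring by restricting the
  carrier, i.e. in the form \<open>S\<lparr>carrier := T\<rparr>\<close>.
\<close>

definition ring_extension :: "'a set \<Rightarrow> ('a, 'b) ring_scheme \<Rightarrow> bool" where
  "ring_extension R S \<longleftrightarrow> cring S \<and> subring R S \<and> R \<noteq> carrier S"

text \<open>
  Library subrings contain the unit, so a subring is an \<open>R\<close>-subalgebra exactly when it
  contains \<open>R\<close> (the structure map being the inclusion of \<open>R\<close>). The locale \<open>subalgebra\<close> of
  HOL-Algebra is not meant here: it only describes submodules.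
\<close>

definition subalgebras :: "'a set \<Rightarrow> ('a, 'b) ring_scheme \<Rightarrow> 'a set set" where
  "subalgebras R S = {T. subring T S \<and> R \<subseteq> T}"

definition minimal_extension :: "'a set \<Rightarrow> ('a, 'b) ring_scheme \<Rightarrow> bool" where
  "minimal_extension R S \<longleftrightarrow> ring_extension R S \<and> subalgebras R S = {R, carrier S}"

text \<open>
  The value is \<open>\<infinity>\<close> when there are chains of unbounded length.
\<close>

definition extension_length :: "'a set \<Rightarrow> ('a, 'b) ring_scheme \<Rightarrow> enat" where
  "extension_length R S =
     Sup {enat n | n. \<exists>C :: nat \<Rightarrow> 'a set.
            (\<forall>i\<le>n. C i \<in> subalgebras R S) \<and> (\<forall>i<n. C i \<subset> C (Suc i))}"

end

(* Both families of extensions live inside the poset [R,S]: [R,T] and [T,S] are its initial and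
   final segments. Hence each of the three conditions says that [R,S] contains no chain
   R < T < U < S. *)

theory Submission
  imports Defs
begin

section \<open>Intermediate rings and the segments of their poset\<close>

lemma (in ring) subring_of_subring_iff:
  assumes "subring T R"
  shows "subring U (R\<lparr>carrier := T\<rparr>) \<longleftrightarrow> subring U R \<and> U \<subseteq> T"
proof -
  \<comment> \<open>Restricting the carrier to \<open>T\<close> and then to \<open>U\<close> gives
    the same record as restricting to \<open>U\<close> at once, so both notions of subring reduce to
    the same ring.\<close>
  have "subring U (R\<lparr>carrier := T\<rparr>) \<longleftrightarrow> ring (R\<lparr>carrier := U\<rparr>)" if "U \<subseteq> T"
    using ring.subring_iff[OF subring_is_ring[OF assms], of U] that by simp
  moreover have "subring U R \<longleftrightarrow> ring (R\<lparr>carrier := U\<rparr>)" if "U \<subseteq> T"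
    using subring_iff[of U] subringE(1)[OF assms] that by blast
  moreover have "U \<subseteq> T" if "subring U (R\<lparr>carrier := T\<rparr>)"
    using subringE(1)[OF that] by simp
  ultimately show ?thesis by blast
qed

lemma subalgebras_subset:
  assumes "T \<in> subalgebras R S"
  shows "R \<subseteq> T" and "T \<subseteq> carrier S"
  using assms subringE(1) unfolding subalgebras_def by auto

lemma bottom_in_subalgebras: "ring_extension R S \<Longrightarrow> R \<in> subalgebras R S"
  by (simp add: ring_extension_def subalgebras_def)

lemma top_in_subalgebras:
  assumes "ring_extension R S"
  shows "carrier S \<in> subalgebras R S"
  using assms ring.carrier_is_subring[of S] subringE(1)[of R S]
  by (auto simp: ring_extension_def subalgebras_def cring.axioms(1))

text \<open>Operations on \<open>T\<close> are inherited from \<open>S\<close>, so passing to the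
  smaller ring only adds the bound \<open>U \<subseteq> T\<close>: this is [R,T] as an initial
  segment of [R,S].\<close>

lemma subalgebras_carrier_update:
  assumes "ring_extension R S" and "T \<in> subalgebras R S"
  shows "subalgebras R (S\<lparr>carrier := T\<rparr>) = {U \<in> subalgebras R S. U \<subseteq> T}"
  using assms ring.subring_of_subring_iff[of S T]
  by (auto simp: ring_extension_def subalgebras_def cring.axioms(1))

lemma subalgebras_over_subalgebra:
  assumes "T \<in> subalgebras R S"
  shows "subalgebras T S = {U \<in> subalgebras R S. T \<subseteq> U}"
  using assms by (auto simp: subalgebras_def)

lemma ring_extension_carrier_update:
  assumes "ring_extension R S" and "T \<in> subalgebras R S" and "T \<noteq> R"
  shows "ring_extension R (S\<lparr>carrier := T\<rparr>)"
proof -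
  interpret cring S using assms(1) by (simp add: ring_extension_def)
  have T: "subring T S" using assms(2) by (simp add: subalgebras_def)
  \<comment> \<open>Commutativity passes from \<open>S\<close> to each of its subrings.\<close>
  have "cring (S\<lparr>carrier := T\<rparr>)"
    using subcringI'[OF T] subcring_iff[OF subringE(1)[OF T]] by simp
  moreover have "subring R (S\<lparr>carrier := T\<rparr>)"
    using assms subring_of_subring_iff[OF T]
    by (auto simp: ring_extension_def subalgebras_def)
  ultimately show ?thesis using assms(3) by (simp add: ring_extension_def)
qed

lemma ring_extension_over_subalgebra:
  assumes "ring_extension R S" and "T \<in> subalgebras R S" and "T \<noteq> carrier S"
  shows "ring_extension T S"
  using assms by (simp add: ring_extension_def subalgebras_def)

section \<open>Minimality as a condition on the poset\<close>

lemma minimal_extension_carrier_update_iff: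
  assumes "ring_extension R S" and "T \<in> subalgebras R S" and "T \<noteq> R"
  shows "minimal_extension R (S\<lparr>carrier := T\<rparr>) \<longleftrightarrow>
    (\<forall>U \<in> subalgebras R S. U \<subset> T \<longrightarrow> U = R)"
  using assms ring_extension_carrier_update[OF assms] subalgebras_subset(1)[OF assms(2)]
    bottom_in_subalgebras[OF assms(1)]
  by (auto simp: minimal_extension_def subalgebras_carrier_update)

text \<open>Dual to the previous equivalence: the larger ring stays \<open>S\<close> and the base
  moves up to \<open>T\<close>, so the final segment above \<open>T\<close> decides.\<close>

lemma minimal_extension_over_subalgebra_iff:
  assumes "ring_extension R S" and "T \<in> subalgebras R S" and "T \<noteq> carrier S"
  shows "minimal_extension T S \<longleftrightarrow>
    (\<forall>U \<in> subalgebras R S. T \<subset> U \<longrightarrow> U = carrier S)"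
  using assms ring_extension_over_subalgebra[OF assms] subalgebras_subset(2)[OF assms(2)]
    top_in_subalgebras[OF assms(1)]
  by (auto simp: minimal_extension_def subalgebras_over_subalgebra)

definition has_intermediate_pair :: "'a set \<Rightarrow> ('a, 'b) ring_scheme \<Rightarrow> bool" where
  "has_intermediate_pair R S \<longleftrightarrow>
    (\<exists>T \<in> subalgebras R S. \<exists>U \<in> subalgebras R S. R \<subset> T \<and> T \<subset> U \<and> U \<subset> carrier S)"

text \<open>Membership already gives \<open>R \<subseteq> T\<close> and
  \<open>U \<subseteq> carrier S\<close>, so the two inequalities become strict inclusions.\<close>

lemma has_intermediate_pairI:
  assumes "T \<in> subalgebras R S" and "U \<in> subalgebras R S"
    and "T \<noteq> R" and "T \<subset> U" and "U \<noteq> carrier S"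
  shows "has_intermediate_pair R S"
  using assms subalgebras_subset(1)[OF assms(1)] subalgebras_subset(2)[OF assms(2)]
  unfolding has_intermediate_pair_def by blast

lemma all_lower_minimal_iff:
  assumes "ring_extension R S"
  shows "(\<forall>T \<in> subalgebras R S. T \<noteq> R \<and> T \<noteq> carrier S
      \<longrightarrow> minimal_extension R (S\<lparr>carrier := T\<rparr>)) \<longleftrightarrow> \<not> has_intermediate_pair R S"
proof -
  have "(\<forall>T \<in> subalgebras R S. T \<noteq> R \<and> T \<noteq> carrier S
      \<longrightarrow> minimal_extension R (S\<lparr>carrier := T\<rparr>)) \<longleftrightarrow>
    (\<forall>T \<in> subalgebras R S. T \<noteq> R \<and> T \<noteq> carrier S
      \<longrightarrow> (\<forall>U \<in> subalgebras R S. U \<subset> T \<longrightarrow> U = R))" (is "_ \<longleftrightarrow> ?L")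
    using minimal_extension_carrier_update_iff[OF assms] by simp
  also have "\<dots> \<longleftrightarrow> \<not> has_intermediate_pair R S"
  proof
    assume L: "?L"
    show "\<not> has_intermediate_pair R S"
    proof
      assume "has_intermediate_pair R S"
      then obtain T U where TU: "T \<in> subalgebras R S" "U \<in> subalgebras R S"
          "R \<subset> T" "T \<subset> U" "U \<subset> carrier S"
        unfolding has_intermediate_pair_def by blast
      \<comment> \<open>The upper member \<open>U\<close> is the one whose extension of
        \<open>R\<close> fails to be minimal, with \<open>T\<close> as the obstruction.\<close>
      then have "U \<noteq> R" "U \<noteq> carrier S" by auto
      then show False
        using L[rule_format, OF TU(2) _ TU(1,4)] TU(3) by simp
    qed
  next
    assume none: "\<not> has_intermediate_pair R S"
    show "?L"
    proof (intro ballI impI)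
      fix T U assume TU: "T \<in> subalgebras R S" "T \<noteq> R \<and> T \<noteq> carrier S"
        "U \<in> subalgebras R S" "U \<subset> T"
      show "U = R"
      proof (rule ccontr)
        assume "U \<noteq> R"
        then have "has_intermediate_pair R S"
          using TU by (intro has_intermediate_pairI[of U R S T]) simp_all
        with none show False by contradiction
      qed
    qed
  qed
  finally show ?thesis .
qed

lemma all_upper_minimal_iff:
  assumes "ring_extension R S"
  shows "(\<forall>T \<in> subalgebras R S. T \<noteq> R \<and> T \<noteq> carrier S
      \<longrightarrow> minimal_extension T S) \<longleftrightarrow> \<not> has_intermediate_pair R S"
proof -
  have "(\<forall>T \<in> subalgebras R S. T \<noteq> R \<and> T \<noteq> carrier S
      \<longrightarrow> minimal_extension T S) \<longleftrightarrow>
    (\<forall>T \<in> subalgebras R S. T \<noteq> R \<and> T \<noteq> carrier S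
      \<longrightarrow> (\<forall>U \<in> subalgebras R S. T \<subset> U \<longrightarrow> U = carrier S))" (is "_ \<longleftrightarrow> ?L")
    using minimal_extension_over_subalgebra_iff[OF assms] by simp
  also have "\<dots> \<longleftrightarrow> \<not> has_intermediate_pair R S"
  proof
    assume L: "?L"
    show "\<not> has_intermediate_pair R S"
    proof
      assume "has_intermediate_pair R S"
      then obtain T U where TU: "T \<in> subalgebras R S" "U \<in> subalgebras R S"
          "R \<subset> T" "T \<subset> U" "U \<subset> carrier S"
        unfolding has_intermediate_pair_def by blast
      \<comment> \<open>Now the lower member \<open>T\<close> is the bad one: \<open>U\<close> lies
        strictly between it and \<open>carrier S\<close>.\<close>
      then have "T \<noteq> R" "T \<noteq> carrier S" by auto
      then show False
        using L[rule_format, OF TU(1) _ TU(2,4)] TU(5) by simp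
    qed
  next
    assume none: "\<not> has_intermediate_pair R S"
    show "?L"
    proof (intro ballI impI)
      fix T U assume TU: "T \<in> subalgebras R S" "T \<noteq> R \<and> T \<noteq> carrier S"
        "U \<in> subalgebras R S" "T \<subset> U"
      show "U = carrier S"
      proof (rule ccontr)
        assume "U \<noteq> carrier S"
        then have "has_intermediate_pair R S"
          using TU by (intro has_intermediate_pairI[of T R S U]) simp_all
        with none show False by contradiction
      qed
    qed
  qed
  finally show ?thesis .
qed

section \<open>Lengths of chains\<close>

lemma extension_length_ge:
  assumes "\<And>i. i \<le> n \<Longrightarrow> C i \<in> subalgebras R S" and "\<And>i. i < n \<Longrightarrow> C i \<subset> C (Suc i)"
  shows "enat n \<le> extension_length R S"
  unfolding extension_length_def using assms by (intro Sup_upper) blast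

lemma extension_length_le:
  assumes "\<And>n C. (\<forall>i\<le>n. C i \<in> subalgebras R S) \<Longrightarrow> (\<forall>i<n. C i \<subset> C (Suc i)) \<Longrightarrow> n \<le> m"
  shows "extension_length R S \<le> enat m"
  unfolding extension_length_def by (rule Sup_least) (use assms in fastforce)

lemma extension_length_ge_3:
  assumes "ring_extension R S" and "has_intermediate_pair R S"
  shows "3 \<le> extension_length R S"
proof -
  obtain T U where TU: "T \<in> subalgebras R S" "U \<in> subalgebras R S" "R \<subset> T" "T \<subset> U" "U \<subset> carrier S"
    using assms(2) unfolding has_intermediate_pair_def by blast
  have "enat 3 \<le> extension_length R S"
  proof (rule extension_length_ge)
    \<comment> \<open>A chain of length 3 has four members. Only \<open>C 0\<close> to
      \<open>C 3\<close> are constrained, so indexing into a four-element list serves as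
      \<open>C\<close>.\<close>
    show "[R, T, U, carrier S] ! i \<in> subalgebras R S" if "i \<le> 3" for i
      using that TU bottom_in_subalgebras[OF assms(1)] top_in_subalgebras[OF assms(1)]
      by (auto simp: le_Suc_eq numeral_3_eq_3)
    show "[R, T, U, carrier S] ! i \<subset> [R, T, U, carrier S] ! Suc i" if "i < 3" for i
      using that TU(3-5) by (auto simp: less_Suc_eq numeral_3_eq_3)
  qed
  then show ?thesis by (simp add: numeral_eq_enat)
qed

lemma extension_length_ge_2:
  assumes "ring_extension R S" and "\<not> minimal_extension R S"
  shows "2 \<le> extension_length R S"
proof -
  \<comment> \<open>The extension is proper, so minimality can only fail through a third member of
    \<open>subalgebras R S\<close> besides \<open>R\<close> and \<open>carrier S\<close>.\<close>
  obtain T where T: "T \<in> subalgebras R S" "R \<subset> T" "T \<subset> carrier S"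
    using assms bottom_in_subalgebras[OF assms(1)] top_in_subalgebras[OF assms(1)]
      subalgebras_subset[of _ R S]
    unfolding minimal_extension_def by blast
  have "enat 2 \<le> extension_length R S"
  proof (rule extension_length_ge)
    show "[R, T, carrier S] ! i \<in> subalgebras R S" if "i \<le> 2" for i
      using that T bottom_in_subalgebras[OF assms(1)] top_in_subalgebras[OF assms(1)]
      by (auto simp: le_Suc_eq numeral_2_eq_2)
    show "[R, T, carrier S] ! i \<subset> [R, T, carrier S] ! Suc i" if "i < 2" for i
      using that T(2,3) by (auto simp: less_Suc_eq numeral_2_eq_2)
  qed
  then show ?thesis by (simp add: numeral_eq_enat)
qed

text \<open>In a chain of length at least 3, the members \<open>C 1\<close> and \<open>C 2\<close>
  form an intermediate pair. The chain may start above \<open>R\<close> and end below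
  \<open>carrier S\<close>; the strict steps from \<open>C 0\<close> and to \<open>C 3\<close> keep
  the two inner members away from both ends.\<close>

lemma extension_length_le_2:
  assumes "\<not> has_intermediate_pair R S"
  shows "extension_length R S \<le> 2"
proof -
  have "extension_length R S \<le> enat 2"
  proof (rule extension_length_le, rule ccontr)
    fix n and C :: "nat \<Rightarrow> 'a set"
    assume C: "\<forall>i\<le>n. C i \<in> subalgebras R S" and step: "\<forall>i<n. C i \<subset> C (Suc i)"
      and "\<not> n \<le> 2"
    then have C_mem: "C 0 \<in> subalgebras R S" "C 1 \<in> subalgebras R S" "C 2 \<in> subalgebras R S"
        "C 3 \<in> subalgebras R S"
      by simp_all
    have "C 0 \<subset> C 1" "C 1 \<subset> C 2" "C 2 \<subset> C 3"
      using step[rule_format, of 0] step[rule_format, of 1] step[rule_format, of 2] \<open>\<not> n \<le> 2\<close>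
      by (simp_all add: numeral_2_eq_2 numeral_3_eq_3)
    moreover from this have "R \<subset> C 1" "C 2 \<subset> carrier S"
      using subalgebras_subset(1)[OF C_mem(1)] subalgebras_subset(2)[OF C_mem(4)] by blast+
    ultimately have "has_intermediate_pair R S"
      using C_mem unfolding has_intermediate_pair_def by blast
    with assms show False by contradiction
  qed
  then show ?thesis by (simp add: numeral_eq_enat)
qed

text \<open>Non-minimality supplies the lower bound 2 and the absence of a pair the upper bound;
  conversely, a pair would force length at least 3.\<close>

lemma extension_length_eq_2_iff:
  assumes "ring_extension R S" and "\<not> minimal_extension R S"
  shows "extension_length R S = 2 \<longleftrightarrow> \<not> has_intermediate_pair R S"
proof
  assume "extension_length R S = 2"
  then show "\<not> has_intermediate_pair R S"
    using extension_length_ge_3[OF assms(1)] by (auto simp: numeral_eq_enat)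
next
  assume "\<not> has_intermediate_pair R S"
  then show "extension_length R S = 2"
    by (intro order_antisym extension_length_le_2 extension_length_ge_2 assms)
qed

section \<open>Exactly three intermediate rings\<close>

lemma no_intermediate_pair_if_card_eq_3:
  assumes "ring_extension R S" and "card (subalgebras R S) = 3"
  shows "\<not> has_intermediate_pair R S"
proof
  assume "has_intermediate_pair R S"
  then obtain T U where TU: "T \<in> subalgebras R S" "U \<in> subalgebras R S"
      "R \<subset> T" "T \<subset> U" "U \<subset> carrier S"
    unfolding has_intermediate_pair_def by blast
  \<comment> \<open>\<open>card\<close> is 0 on infinite sets, so the value 3 forces finiteness,
    which \<open>card_mono\<close> requires.\<close>
  have "finite (subalgebras R S)"
    using assms(2) by (intro card_ge_0_finite) simp
  then have "card {R, T, U, carrier S} \<le> card (subalgebras R S)"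
    using TU bottom_in_subalgebras[OF assms(1)] top_in_subalgebras[OF assms(1)]
    by (intro card_mono) auto
  moreover have "R \<notin> {T, U, carrier S}" "T \<notin> {U, carrier S}" "U \<noteq> carrier S"
    using TU(3-5) by auto
  then have "card {R, T, U, carrier S} = 4" by simp
  ultimately show False using assms(2) by simp
qed

text \<open>Supplies the non-minimality under which length 2 is characterised, so that the count
  alone yields the final claim.\<close>

lemma not_minimal_if_card_eq_3:
  assumes "card (subalgebras R S) = 3"
  shows "\<not> minimal_extension R S"
proof
  assume "minimal_extension R S"
  then have "subalgebras R S = {R, carrier S}" by (simp add: minimal_extension_def)
  moreover have "card {R, carrier S} \<le> 2" by (simp add: card_insert_if)
  ultimately show False using assms by simp
qed

theorem theorem2p1:
  fixes R :: "'a set" and S :: "('a, 'b) ring_scheme"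
  assumes "ring_extension R S"
  shows "(\<not> minimal_extension R S \<longrightarrow>
            ((\<forall>T \<in> subalgebras R S. T \<noteq> R \<and> T \<noteq> carrier S
                 \<longrightarrow> minimal_extension R (S\<lparr>carrier := T\<rparr>))
             \<longleftrightarrow> (\<forall>T \<in> subalgebras R S. T \<noteq> R \<and> T \<noteq> carrier S
                 \<longrightarrow> minimal_extension T S))
          \<and> ((\<forall>T \<in> subalgebras R S. T \<noteq> R \<and> T \<noteq> carrier S
                 \<longrightarrow> minimal_extension T S)
             \<longleftrightarrow> extension_length R S = 2))
         \<and> (card (subalgebras R S) = 3 \<longrightarrow> extension_length R S = 2)"
  \<comment> \<open>What remains is propositional: the three conditions meet in
    \<open>\<not> has_intermediate_pair R S\<close>, which cardinality 3 also implies.\<close>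
  using all_lower_minimal_iff[OF assms] all_upper_minimal_iff[OF assms]
    extension_length_eq_2_iff[OF assms] no_intermediate_pair_if_card_eq_3[OF assms]
    not_minimal_if_card_eq_3[of R S]
  by blast

end
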